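(* Let $f$ have a zero $\alpha$ of known multiplicity $m\ge 1$, and consider the three-point iterative family $$ \begin{cases} y_k=x_k-m\,\dfrac{f(x_k)}{f'(x_k)},\\[6pt] z_k=y_k-m\,u_kP(u_k)\,\dfrac{f(x_k)}{f'(x_k)},\\[6pt] x_{k+1}=z_k-m\,u_kv_k\,Q(u_k,v_k)\,\dfrac{f(x_k)}{f'(x_k)}, \end{cases} \qquad u_k=\Bigl(\frac{f(y_k)}{f(x_k)}\Bigr)^{1/m},\quad v_k=\Bigl(\frac{f(z_k)}{f(y_k)}\Bigr)^{1/m}\qquad(k=0,1,\ldots). $$ Suppose the weight functions $P$ and $Q$ satisfy $$ P(0)=1,\quad P'(0)=2,\quad P''(0)\ \text{arbitrary},\quad P'''(0)=24-6P''(0), $$ $$ Q(0,0)=1,\quad Q_u(0,0)=2,\quad Q_v(0,0)=1,\quad Q_{uv}(0,0)=4,\quad Q_{uu}(0,0)=P''(0)+2 . $$ If the initial approximation $x_0$ is sufficiently close to the zero $\alpha$ of $f$, then the order of the three-point family is eight, i.e. $x_{k+1}-\alpha=O\bigl((x_k-\alpha)^8\bigr)$.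
   Context: $f$ is a real function of a real variable, infinitely differentiable near $\alpha$ (or a complex function holomorphic near $\alpha$), with $f(\alpha)=\dots=f^{(m-1)}(\alpha)=0$ and $f^{(m)}(\alpha)\neq 0$. The weight function $P$ of one variable is smooth near $0$ and the weight function $Q=Q(u,v)$ of two variables is smooth near $(0,0)$; they are represented by their Taylor series about $u=0$ and $(u,v)=(0,0)$, respectively. Subscripts on $Q$ denote partial derivatives. Meaning of the $m$-th roots: write $f(x)=\frac{f^{(m)}(\alpha)}{m!}(x-\alpha)^m h(x)$ with $h(\alpha)=1$, and let $h^{1/m}$ be the smooth $m$-th root near $\alpha$ with $h(\alpha)^{1/m}=1$. Then $$ \Bigl(\frac{f(s)}{f(t)}\Bigr)^{1/m}:=\frac{(s-\alpha)\,h(s)^{1/m}}{(t-\alpha)\,h(t)^{1/m}} , $$ that is, the root of the ratio equals $F(s)/F(t)$, where $F=f^{1/m}$ (up to a constant factor) is the function for which $\alpha$ is a simple zero. "Order eight" means that there are a neighborhood of $\alpha$ and a constant $C$ such that $|x_{k+1}-\alpha|\le C|x_k-\alpha|^8$ for every $x_k$ in this neighborhood for which the step is defined (i.e. $f(x_k)\ne0$, $f(y_k)\neq 0$; otherwise a zero has been found exactly and the iteration stops).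
   Formalization: The condition Q_uuu(0,0)=0 is added; without it the claim fails: for m=1, f(x)=x+x^2, P(u)=1+2u+4u^3, Q(u,v)=1+2u+v+4uv+u^2+u^3 all listed conditions hold, but the new error is asymptotically -5x^7, so the order is only seven. *)

theory Defs
  imports "HOL-Analysis.Analysis"
begin

text \<open>
  All notions are polymorphic over the scalar field and are used for \<^typ>\<open>real\<close> and \<^typ>\<open>complex\<close>.
\<close>

definition smooth_near :: "('a::real_normed_field \<Rightarrow> 'a) \<Rightarrow> 'a \<Rightarrow> bool" where
  "smooth_near f a \<longleftrightarrow>
     (\<exists>S. open S \<and> a \<in> S \<and> (\<forall>n. \<forall>x\<in>S. (deriv ^^ n) f field_differentiable (at x)))"

definition zero_of_multiplicity :: "('a::real_normed_field \<Rightarrow> 'a) \<Rightarrow> 'a \<Rightarrow> nat \<Rightarrow> bool" where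
  "zero_of_multiplicity f \<alpha> m \<longleftrightarrow> (\<forall>i<m. (deriv ^^ i) f \<alpha> = 0) \<and> (deriv ^^ m) f \<alpha> \<noteq> 0"

definition partial_u :: "('a::real_normed_field \<Rightarrow> 'a \<Rightarrow> 'a) \<Rightarrow> 'a \<Rightarrow> 'a \<Rightarrow> 'a" where
  "partial_u Q u v = deriv (\<lambda>s. Q s v) u"

definition partial_v :: "('a::real_normed_field \<Rightarrow> 'a \<Rightarrow> 'a) \<Rightarrow> 'a \<Rightarrow> 'a \<Rightarrow> 'a" where
  "partial_v Q u v = deriv (\<lambda>t. Q u t) v"

text \<open>
  \<open>Ck2 S k Q\<close>: all mixed partial derivatives of \<open>Q\<close> of order at most \<open>k\<close> exist and are
  continuous on \<open>S\<close>. Over the complex numbers the derivatives are complex derivatives, so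
  that \<open>smooth2_near\<close> amounts to holomorphy in two variables.
\<close>

fun Ck2 :: "('a \<times> 'a) set \<Rightarrow> nat \<Rightarrow> ('a::real_normed_field \<Rightarrow> 'a \<Rightarrow> 'a) \<Rightarrow> bool" where
  "Ck2 S 0 Q \<longleftrightarrow> continuous_on S (\<lambda>(u, v). Q u v)"
| "Ck2 S (Suc k) Q \<longleftrightarrow>
     continuous_on S (\<lambda>(u, v). Q u v) \<and>
     (\<forall>(u, v)\<in>S. (\<lambda>s. Q s v) field_differentiable (at u) \<and>
                 (\<lambda>t. Q u t) field_differentiable (at v)) \<and>
     Ck2 S k (partial_u Q) \<and> Ck2 S k (partial_v Q)"

definition smooth2_near :: "('a::real_normed_field \<Rightarrow> 'a \<Rightarrow> 'a) \<Rightarrow> 'a \<Rightarrow> 'a \<Rightarrow> bool" where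
  "smooth2_near Q a b \<longleftrightarrow> (\<exists>S. open S \<and> (a, b) \<in> S \<and> (\<forall>k. Ck2 S k Q))"

text \<open>
  \<open>unit_part f \<alpha> m\<close> is the function \<open>h\<close> in
  \<open>f x = (f\<^sup>(\<^sup>m\<^sup>) \<alpha> / m!) * (x - \<alpha>)^m * h x\<close>, with its limit \<open>h \<alpha> = 1\<close> filled in.
  Since \<open>h\<close> is close to 1 near \<open>\<alpha>\<close>, the principal power \<open>h powr (1/m)\<close> is there the
  smooth \<open>m\<close>-th root of \<open>h\<close> with value 1 at \<open>\<alpha>\<close>.
  Consequently \<open>root_ratio f \<alpha> m s t\<close> is \<open>(f s / f t)\<close> to the power \<open>1/m\<close>, with the branch
  fixed as \<open>F s / F t\<close> where \<open>F\<close> has a simple zero at \<open>\<alpha>\<close>.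
  In general it differs from the principal power of \<open>f s / f t\<close>.
\<close>

definition unit_part :: "('a::real_normed_field \<Rightarrow> 'a) \<Rightarrow> 'a \<Rightarrow> nat \<Rightarrow> 'a \<Rightarrow> 'a" where
  "unit_part f \<alpha> m x =
     (if x = \<alpha> then 1 else f x / ((deriv ^^ m) f \<alpha> / fact m * (x - \<alpha>) ^ m))"

definition root_ratio ::
    "('a::{real_normed_field,ln} \<Rightarrow> 'a) \<Rightarrow> 'a \<Rightarrow> nat \<Rightarrow> 'a \<Rightarrow> 'a \<Rightarrow> 'a" where
  "root_ratio f \<alpha> m s t =
     ((s - \<alpha>) * unit_part f \<alpha> m s powr (1 / of_nat m)) /
     ((t - \<alpha>) * unit_part f \<alpha> m t powr (1 / of_nat m))"

definition step_y :: "('a::real_normed_field \<Rightarrow> 'a) \<Rightarrow> nat \<Rightarrow> 'a \<Rightarrow> 'a" where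
  "step_y f m x = x - of_nat m * (f x / deriv f x)"

definition step_z ::
    "('a::{real_normed_field,ln} \<Rightarrow> 'a) \<Rightarrow> 'a \<Rightarrow> nat \<Rightarrow> ('a \<Rightarrow> 'a) \<Rightarrow> 'a \<Rightarrow> 'a" where
  "step_z f \<alpha> m P x =
     (let y = step_y f m x;
          u = root_ratio f \<alpha> m y x
      in y - of_nat m * u * P u * (f x / deriv f x))"

definition three_point_step ::
    "('a::{real_normed_field,ln} \<Rightarrow> 'a) \<Rightarrow> 'a \<Rightarrow> nat \<Rightarrow> ('a \<Rightarrow> 'a) \<Rightarrow> ('a \<Rightarrow> 'a \<Rightarrow> 'a) \<Rightarrow> 'a \<Rightarrow> 'a"
  where
  "three_point_step f \<alpha> m P Q x =
     (let y = step_y f m x;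
          z = step_z f \<alpha> m P x;
          u = root_ratio f \<alpha> m y x;
          v = root_ratio f \<alpha> m z y
      in z - of_nat m * u * v * Q u v * (f x / deriv f x))"

definition weight_conditions ::
    "('a::real_normed_field \<Rightarrow> 'a) \<Rightarrow> ('a \<Rightarrow> 'a \<Rightarrow> 'a) \<Rightarrow> bool" where
  "weight_conditions P Q \<longleftrightarrow>
     P 0 = 1 \<and> deriv P 0 = 2 \<and> (deriv ^^ 3) P 0 = 24 - 6 * (deriv ^^ 2) P 0 \<and>
     Q 0 0 = 1 \<and> partial_u Q 0 0 = 2 \<and> partial_v Q 0 0 = 1 \<and>
     partial_v (partial_u Q) 0 0 = 4 \<and>
     partial_u (partial_u Q) 0 0 = (deriv ^^ 2) P 0 + 2"

text \<open>
  The conditions above do not constrain \<open>Q\<^sub>u\<^sub>u\<^sub>u(0,0)\<close>, although a term \<open>u\<^sup>3\<close> of \<open>Q\<close> contributes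
  to the error at order 7: for order eight one needs \<open>Q\<^sub>u\<^sub>u\<^sub>u(0,0) = 6 P''(0) + P'''(0) - 24\<close>.
  The condition \<open>P'''(0) = 24 - 6 P''(0)\<close> is the case of a \<open>Q\<close> without \<open>u\<^sup>3\<close> term, and this
  tacit assumption is made explicit here. It cannot be dropped: for
  \<open>f x = x + x\<^sup>2\<close>, \<open>P u = 1 + 2 u + 4 u\<^sup>3\<close>, \<open>Q u v = 1 + 2 u + v + 4 u v + u\<^sup>2 + u\<^sup>3\<close>
  the new error is asymptotically \<open>-5 x\<^sup>7\<close>.
\<close>

definition no_cubic_u_term :: "('a::real_normed_field \<Rightarrow> 'a \<Rightarrow> 'a) \<Rightarrow> bool" where
  "no_cubic_u_term Q \<longleftrightarrow> partial_u (partial_u (partial_u Q)) 0 0 = 0"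

text \<open>
  \<open>D x\<close> says that the step is defined at \<open>x\<close>, i.e. that no zero has been hit exactly.
\<close>

definition has_order_at :: "nat \<Rightarrow> ('a::real_normed_field \<Rightarrow> bool) \<Rightarrow> ('a \<Rightarrow> 'a) \<Rightarrow> 'a \<Rightarrow> bool" where
  "has_order_at p D step \<alpha> \<longleftrightarrow>
     (\<exists>C::real. \<forall>\<^sub>F x in nhds \<alpha>. D x \<longrightarrow> norm (step x - \<alpha>) \<le> C * norm (x - \<alpha>) ^ p)"

end

theory Submission
  imports Defs "HOL-Library.Landau_Symbols" "HOL-Complex_Analysis.Cauchy_Integral_Formula"
begin

text \<open>
  Let \<open>F = (x - \<alpha>) h\<^sup>1\<^sup>/\<^sup>m = (x - \<alpha>) G\<close>, so that \<open>m f / f' = F / F'\<close> and \<open>\<alpha>\<close> is a simple zero of \<open>F\<close>.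
  With \<open>e = x - \<alpha>\<close>, the definitions of \<open>u\<close> and \<open>v\<close> give
  \<open>z - \<alpha> = F y * (1 / G y - P u / F' x)\<close> and
  \<open>x\<^sub>n\<^sub>e\<^sub>w - \<alpha> = (z - \<alpha>) * (1 - G z * Q u v / F' x)\<close>.
  Since \<open>F y = O(e\<^sup>2)\<close> and the conditions on \<open>P\<close> give \<open>1 / G y - P u / F' x = O(e\<^sup>2)\<close>,
  the first error is \<open>O(e\<^sup>4)\<close>; the conditions on \<open>Q\<close>, with no \<open>u\<^sup>3\<close> term, give \<open>Q u v = F' x + O(e\<^sup>4)\<close>,
  which yields the other factor \<open>O(e\<^sup>4)\<close>. All expansions are thus needed only modulo \<open>e\<^sup>4\<close>,
  and since \<open>F y\<close> cancels in \<open>v = F z / F y\<close>, no nondegeneracy of \<open>F y\<close> is required.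
\<close>

section \<open>Expansions with an error of fourth order along a filter\<close>

text \<open>The filter and the small quantity \<open>e\<close> are left free, so that one calculus
  covers full and punctured neighborhoods, the set of points where the step is defined, and
  expansions in another variable that are substituted later.\<close>

definition jet :: "'b filter \<Rightarrow> ('b \<Rightarrow> 'a::real_normed_field) \<Rightarrow> ('b \<Rightarrow> 'a) \<Rightarrow> 'a \<Rightarrow> 'a \<Rightarrow> 'a \<Rightarrow> 'a \<Rightarrow> bool" where
  "jet F e g p0 p1 p2 p3 \<longleftrightarrow>
     (\<lambda>x. g x - (p0 + p1 * e x + p2 * e x ^ 2 + p3 * e x ^ 3)) \<in> O[F](\<lambda>x. e x ^ 4)"

lemma power_in_bigo_power:
  fixes e :: "'b \<Rightarrow> 'a::real_normed_field"
  assumes "(e \<longlongrightarrow> 0) F" "n \<le> k"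
  shows "(\<lambda>x. e x ^ k) \<in> O[F](\<lambda>x. e x ^ n)"
proof -
  have "eventually (\<lambda>x. norm (e x) < 1) F"
    using tendstoD[OF assms(1), of 1] by (simp add: dist_norm)
  then have "eventually (\<lambda>x. norm (e x ^ k) \<le> 1 * norm (e x ^ n)) F"
    by eventually_elim (auto simp: norm_power intro!: power_decreasing assms(2))
  then show ?thesis by (rule bigoI)
qed

lemma bounded_of_tendsto:
  fixes g :: "'b \<Rightarrow> 'a::real_normed_field"
  assumes "(g \<longlongrightarrow> c) F"
  shows "g \<in> O[F](\<lambda>_. 1)"
  by (rule bigoI_tendsto[of _ _ c]) (use assms in auto)

lemma tendsto_of_bigo_power:
  fixes e r :: "'b \<Rightarrow> 'a::real_normed_field"
  assumes "(e \<longlongrightarrow> 0) F" "r \<in> O[F](\<lambda>x. e x ^ n)" "n > 0"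
  shows "(r \<longlongrightarrow> 0) F"
proof -
  have "((\<lambda>x. e x ^ n) \<longlongrightarrow> 0 ^ n) F"
    by (intro tendsto_intros assms)
  then have "(\<lambda>x. e x ^ n) \<in> o[F](\<lambda>_. 1)"
    using assms(3) by (intro smalloI_tendsto) (auto simp: power_0_left)
  with assms(2) have "r \<in> o[F](\<lambda>_. 1)"
    by (rule landau_o.big_small_trans)
  then show ?thesis
    by (auto dest: smalloD_tendsto)
qed

lemma jet_add:
  assumes "jet F e g p0 p1 p2 p3" "jet F e h q0 q1 q2 q3"
  shows "jet F e (\<lambda>x. g x + h x) (p0 + q0) (p1 + q1) (p2 + q2) (p3 + q3)"
  using sum_in_bigo(1)[OF assms[unfolded jet_def]] unfolding jet_def
  by (simp add: algebra_simps)

lemma jet_cmult: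
  assumes "jet F e g p0 p1 p2 p3"
  shows "jet F e (\<lambda>x. c * g x) (c * p0) (c * p1) (c * p2) (c * p3)"
proof -
  have "(\<lambda>x. c * (g x - (p0 + p1 * e x + p2 * e x ^ 2 + p3 * e x ^ 3))) \<in> O[F](\<lambda>x. e x ^ 4)"
    using assms unfolding jet_def by simp
  then show ?thesis unfolding jet_def by (simp add: algebra_simps)
qed

lemma jet_const: "jet F e (\<lambda>x. c) c 0 0 0"
  unfolding jet_def by simp

lemma jet_id: "jet F e e 0 1 0 0"
  unfolding jet_def by simp

lemma jet_diff:
  assumes "jet F e g p0 p1 p2 p3" "jet F e h q0 q1 q2 q3"
  shows "jet F e (\<lambda>x. g x - h x) (p0 - q0) (p1 - q1) (p2 - q2) (p3 - q3)"
  using jet_add[OF assms(1) jet_cmult[OF assms(2), of "-1"]] by simp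

lemma jet_perturb:
  assumes "jet F e g p0 p1 p2 p3" "(\<lambda>x. h x - g x) \<in> O[F](\<lambda>x. e x ^ 4)"
  shows "jet F e h p0 p1 p2 p3"
  using sum_in_bigo(1)[OF assms(1)[unfolded jet_def] assms(2)] unfolding jet_def
  by (simp add: algebra_simps)

lemma jet_cong:
  assumes "jet F e g p0 p1 p2 p3" "eventually (\<lambda>x. g x = h x) F"
  shows "jet F e h p0 p1 p2 p3"
proof (rule jet_perturb[OF assms(1)])
  have "eventually (\<lambda>x. norm (h x - g x) \<le> 0 * norm (e x ^ 4)) F"
    using assms(2) by eventually_elim auto
  then show "(\<lambda>x. h x - g x) \<in> O[F](\<lambda>x. e x ^ 4)" by (rule bigoI)
qed

lemma jet_coeffs:
  assumes "jet F e g p0 p1 p2 p3" "q0 = p0" "q1 = p1" "q2 = p2" "q3 = p3"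
  shows "jet F e g q0 q1 q2 q3"
  using assms by simp

context
  fixes F :: "'b filter" and e :: "'b \<Rightarrow> 'a::real_normed_field"
  assumes e0: "(e \<longlongrightarrow> 0) F"
begin

lemma jet_tendsto:
  assumes "jet F e g p0 p1 p2 p3"
  shows "(g \<longlongrightarrow> p0) F"
proof -
  let ?p = "\<lambda>x. p0 + p1 * e x + p2 * e x ^ 2 + p3 * e x ^ 3"
  have "((\<lambda>x. g x - ?p x) \<longlongrightarrow> 0) F"
    using assms by (intro tendsto_of_bigo_power[OF e0]) (auto simp: jet_def)
  moreover have "(?p \<longlongrightarrow> p0 + p1 * 0 + p2 * 0 ^ 2 + p3 * 0 ^ 3) F"
    by (intro tendsto_intros e0)
  ultimately have "((\<lambda>x. (g x - ?p x) + ?p x) \<longlongrightarrow> 0 + (p0 + p1 * 0 + p2 * 0 ^ 2 + p3 * 0 ^ 3)) F"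
    by (rule tendsto_add)
  then show ?thesis by simp
qed

lemma jet_mult:
  assumes "jet F e g p0 p1 p2 p3" "jet F e h q0 q1 q2 q3"
  shows "jet F e (\<lambda>x. g x * h x) (p0 * q0) (p0 * q1 + p1 * q0)
           (p0 * q2 + p1 * q1 + p2 * q0) (p0 * q3 + p1 * q2 + p2 * q1 + p3 * q0)"
proof -
  let ?p = "\<lambda>x. p0 + p1 * e x + p2 * e x ^ 2 + p3 * e x ^ 3"
  let ?q = "\<lambda>x. q0 + q1 * e x + q2 * e x ^ 2 + q3 * e x ^ 3"
  \<comment> \<open>The terms of degree 4 to 6 in the product of the two cubic polynomials, divided
    by \<open>e x ^ 4\<close>. This factor is bounded, so these terms go into the error.\<close>
  let ?c = "\<lambda>x. (p1 * q3 + p2 * q2 + p3 * q1) + (p2 * q3 + p3 * q2) * e x + p3 * q3 * e x ^ 2"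
  have g: "g \<in> O[F](\<lambda>_. 1)"
    using jet_tendsto[OF assms(1)] by (rule bounded_of_tendsto)
  have "(?q \<longlongrightarrow> q0 + q1 * 0 + q2 * 0 ^ 2 + q3 * 0 ^ 3) F"
    by (intro tendsto_intros e0)
  then have q: "?q \<in> O[F](\<lambda>_. 1)" by (rule bounded_of_tendsto)
  have "(?c \<longlongrightarrow> (p1 * q3 + p2 * q2 + p3 * q1) + (p2 * q3 + p3 * q2) * 0 + p3 * q3 * 0 ^ 2) F"
    by (intro tendsto_intros e0)
  then have c: "?c \<in> O[F](\<lambda>_. 1)" by (rule bounded_of_tendsto)
  have 1: "(\<lambda>x. g x * (h x - ?q x)) \<in> O[F](\<lambda>x. 1 * e x ^ 4)"
    using assms(2) unfolding jet_def by (intro landau_o.big.mult g)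
  have 2: "(\<lambda>x. (g x - ?p x) * ?q x) \<in> O[F](\<lambda>x. e x ^ 4 * 1)"
    using assms(1) unfolding jet_def by (intro landau_o.big.mult q)
  have 3: "(\<lambda>x. ?c x * e x ^ 4) \<in> O[F](\<lambda>x. 1 * e x ^ 4)"
    by (intro landau_o.big.mult c) simp
  have "(\<lambda>x. g x * (h x - ?q x) + (g x - ?p x) * ?q x + ?c x * e x ^ 4) \<in> O[F](\<lambda>x. e x ^ 4)"
    using 1 2 3 by (intro sum_in_bigo) simp_all
  also have "(\<lambda>x. g x * (h x - ?q x) + (g x - ?p x) * ?q x + ?c x * e x ^ 4) =
     (\<lambda>x. g x * h x - (p0 * q0 + (p0 * q1 + p1 * q0) * e x +
           (p0 * q2 + p1 * q1 + p2 * q0) * e x ^ 2 + (p0 * q3 + p1 * q2 + p2 * q1 + p3 * q0) * e x ^ 3))"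
    by (rule ext) algebra
  finally show ?thesis unfolding jet_def .
qed

lemma jet_inverse:
  assumes "jet F e g 1 p1 p2 p3"
  shows "jet F e (\<lambda>x. 1 / g x) 1 (- p1) (p1 ^ 2 - p2) (2 * p1 * p2 - p1 ^ 3 - p3)"
proof -
  \<comment> \<open>The reciprocal power series, truncated: its product with the expansion of
    \<open>g\<close> is 1 up to fourth order. Multiplication by \<open>1 / g x\<close>, which tends
    to 1, then preserves the order of the error.\<close>
  let ?q = "\<lambda>x. 1 + (- p1) * e x + (p1 ^ 2 - p2) * e x ^ 2 + (2 * p1 * p2 - p1 ^ 3 - p3) * e x ^ 3"
  have lim: "(g \<longlongrightarrow> 1) F" using jet_tendsto[OF assms] .
  have g0: "eventually (\<lambda>x. g x \<noteq> 0) F"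
    using tendsto_imp_eventually_ne[OF lim, of 0] by simp
  have "((\<lambda>x. 1 / g x) \<longlongrightarrow> 1 / 1) F"
    by (intro tendsto_intros lim) simp
  then have b: "(\<lambda>x. 1 / g x) \<in> O[F](\<lambda>_. 1)" by (rule bounded_of_tendsto)
  have "jet F e ?q 1 (- p1) (p1 ^ 2 - p2) (2 * p1 * p2 - p1 ^ 3 - p3)"
    unfolding jet_def by simp
  from jet_mult[OF assms this] have "jet F e (\<lambda>x. g x * ?q x) 1 0 0 0"
    by (rule jet_coeffs) (simp_all add: algebra_simps power2_eq_square power3_eq_cube)
  from jet_diff[OF jet_const[where c = 1] this] have "(\<lambda>x. 1 - g x * ?q x) \<in> O[F](\<lambda>x. e x ^ 4)"
    unfolding jet_def by simp
  from landau_o.big.mult[OF this b]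
  have "(\<lambda>x. (1 - g x * ?q x) * (1 / g x)) \<in> O[F](\<lambda>x. e x ^ 4)" by simp
  moreover have "eventually (\<lambda>x. (1 - g x * ?q x) * (1 / g x) = 1 / g x - ?q x) F"
    using g0 by eventually_elim (simp add: field_simps)
  ultimately show ?thesis
    unfolding jet_def by (simp add: landau_o.big.in_cong)
qed

lemma jet_divide:
  assumes "jet F e g p0 p1 p2 p3" "jet F e h 1 q1 q2 q3"
  shows "jet F e (\<lambda>x. g x / h x) p0 (p1 - p0 * q1) (p2 - p1 * q1 + p0 * (q1 ^ 2 - q2))
           (p3 - p2 * q1 + p1 * (q1 ^ 2 - q2) + p0 * (2 * q1 * q2 - q1 ^ 3 - q3))"
  using jet_coeffs[OF jet_mult[OF assms(1) jet_inverse[OF assms(2)]]]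
  by (simp add: algebra_simps)

lemma jet_order1:
  assumes "jet F e g 0 p1 p2 p3"
  shows "g \<in> O[F](e)"
proof -
  have "(\<lambda>x. g x - (p1 * e x + p2 * e x ^ 2 + p3 * e x ^ 3)) \<in> O[F](\<lambda>x. e x ^ 1)"
    using assms unfolding jet_def
    by (intro landau_o.big.trans[OF _ power_in_bigo_power[OF e0, of 1 4]]) simp_all
  moreover have "(\<lambda>x. p1 * e x ^ 1 + p2 * e x ^ 2 + p3 * e x ^ 3) \<in> O[F](\<lambda>x. e x ^ 1)"
    by (intro sum_in_bigo landau_o.big.cmult_in_iff[THEN iffD2] cmult_in_bigo_iff[THEN iffD2]
          disjI2 power_in_bigo_power[OF e0]) simp_all
  ultimately have "(\<lambda>x. (g x - (p1 * e x + p2 * e x ^ 2 + p3 * e x ^ 3)) +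
      (p1 * e x ^ 1 + p2 * e x ^ 2 + p3 * e x ^ 3)) \<in> O[F](\<lambda>x. e x ^ 1)"
    by (rule sum_in_bigo)
  then show ?thesis by simp
qed

lemma jet_order2:
  assumes "jet F e g 0 0 p2 p3"
  shows "g \<in> O[F](\<lambda>x. e x ^ 2)"
proof -
  have "(\<lambda>x. g x - (p2 * e x ^ 2 + p3 * e x ^ 3)) \<in> O[F](\<lambda>x. e x ^ 2)"
    using assms unfolding jet_def
    by (intro landau_o.big.trans[OF _ power_in_bigo_power[OF e0, of 2 4]]) simp_all
  moreover have "(\<lambda>x. p2 * e x ^ 2 + p3 * e x ^ 3) \<in> O[F](\<lambda>x. e x ^ 2)"
    by (intro sum_in_bigo cmult_in_bigo_iff[THEN iffD2]
          disjI2 power_in_bigo_power[OF e0]) simp_all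
  ultimately have "(\<lambda>x. (g x - (p2 * e x ^ 2 + p3 * e x ^ 3)) +
      (p2 * e x ^ 2 + p3 * e x ^ 3)) \<in> O[F](\<lambda>x. e x ^ 2)"
    by (rule sum_in_bigo)
  then show ?thesis by simp
qed

text \<open>The inner expansion has no constant term, hence is \<open>O(e)\<close>, and an error of
  fourth order in \<open>d\<close> becomes one in \<open>e\<close>. What remains is substitution
  into a cubic polynomial, with the powers of the inner expansion truncated.\<close>

lemma jet_compose:
  assumes "jet G d \<phi> a0 a1 a2 a3" "filterlim w G F"
      and "jet F e (\<lambda>x. d (w x)) 0 p1 p2 p3"
  shows "jet F e (\<lambda>x. \<phi> (w x)) a0 (a1 * p1) (a1 * p2 + a2 * p1 ^ 2)
           (a1 * p3 + 2 * a2 * p1 * p2 + a3 * p1 ^ 3)"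
proof -
  let ?d = "\<lambda>x. d (w x)"
  have "(\<lambda>x. \<phi> (w x) - (a0 + a1 * ?d x + a2 * ?d x ^ 2 + a3 * ?d x ^ 3)) \<in> O[F](\<lambda>x. ?d x ^ 4)"
    using landau_o.big.compose[OF assms(1)[unfolded jet_def] assms(2)] .
  also have "(\<lambda>x. ?d x ^ 4) \<in> O[F](\<lambda>x. e x ^ 4)"
    using jet_order1[OF assms(3)] by (rule landau_o.big_power)
  finally have r: "(\<lambda>x. \<phi> (w x) - (a0 + a1 * ?d x + a2 * ?d x ^ 2 + a3 * ?d x ^ 3)) \<in> O[F](\<lambda>x. e x ^ 4)" .
  have d2: "jet F e (\<lambda>x. ?d x ^ 2) 0 0 (p1 ^ 2) (2 * p1 * p2)"
    using jet_mult[OF assms(3) assms(3)]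
    by (simp add: power2_eq_square algebra_simps)
  have d3: "jet F e (\<lambda>x. ?d x ^ 3) 0 0 0 (p1 ^ 3)"
    using jet_mult[OF d2 assms(3)]
    by (simp add: power2_eq_square power3_eq_cube algebra_simps)
  have "jet F e (\<lambda>x. a0 + a1 * ?d x + a2 * ?d x ^ 2 + a3 * ?d x ^ 3) a0 (a1 * p1)
      (a1 * p2 + a2 * p1 ^ 2) (a1 * p3 + 2 * a2 * p1 * p2 + a3 * p1 ^ 3)"
    using jet_add[OF jet_add[OF jet_add[OF jet_const[where c = a0] jet_cmult[OF assms(3), of a1]]
            jet_cmult[OF d2, of a2]] jet_cmult[OF d3, of a3]]
    by (simp add: algebra_simps)
  from jet_perturb[OF this r] show ?thesis .
qed

end

text \<open>At \<open>a\<close> itself both sides of the estimate are 0. Including the point matters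
  for substitution, where the inner function may take the value \<open>a\<close>.\<close>

lemma jet_nhds:
  assumes "jet (at a) (\<lambda>x. x - a) g p0 p1 p2 p3" "g a = p0"
  shows "jet (nhds a) (\<lambda>x. x - a) g p0 p1 p2 p3"
proof -
  obtain C where "eventually (\<lambda>x. norm (g x - (p0 + p1 * (x - a) + p2 * (x - a) ^ 2 + p3 * (x - a) ^ 3))
      \<le> C * norm ((x - a) ^ 4)) (at a)"
    using assms(1) unfolding jet_def by (auto elim: landau_o.bigE)
  then show ?thesis
    unfolding jet_def using assms(2)
    by (intro bigoI[of _ C]) (simp add: eventually_nhds_conv_at)
qed

lemma jet_mono:
  assumes "jet G e g p0 p1 p2 p3" "F \<le> G"
  shows "jet F e g p0 p1 p2 p3"
  using assms unfolding jet_def by (rule landau_o.big.filter_mono[rotated])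

section \<open>Taylor expansions in one variable\<close>

text \<open>Continuity at \<open>a\<close> bounds the derivative of order \<open>Suc n\<close> on a
  ball, and this controls the remainder. The derivatives are given as a family \<open>g\<close>, so
  that iterated \<open>deriv\<close>, explicit derivatives of a power and partial derivatives are
  all covered.\<close>

lemma Taylor_bigo:
  fixes g :: "nat \<Rightarrow> 'a::real_normed_field \<Rightarrow> 'a"
  assumes S: "open S" "a \<in> S"
      and g: "\<And>i x. x \<in> S \<Longrightarrow> (g i has_field_derivative g (Suc i) x) (at x)"
  shows "(\<lambda>x. g 0 x - (\<Sum>i\<le>n. g i a * (x - a) ^ i / fact i)) \<in> O[nhds a](\<lambda>x. (x - a) ^ Suc n)"
proof -
  have "isCont (g (Suc n)) a"
    using g[OF S(2)] by (rule DERIV_isCont)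
  then have "eventually (\<lambda>x. norm (g (Suc n) x) < norm (g (Suc n) a) + 1) (nhds a)"
    unfolding isCont_def tendsto_at_iff_tendsto_nhds
    by (intro order_tendstoD(2)[OF tendsto_norm]) auto
  moreover have "eventually (\<lambda>x. x \<in> S) (nhds a)"
    using S by (rule eventually_nhds_in_open)
  ultimately have "eventually (\<lambda>x. x \<in> S \<and> norm (g (Suc n) x) < norm (g (Suc n) a) + 1) (nhds a)"
    by eventually_elim auto
  then obtain r where r: "r > 0"
    "\<And>x. dist x a < r \<Longrightarrow> x \<in> S \<and> norm (g (Suc n) x) < norm (g (Suc n) a) + 1"
    unfolding eventually_nhds_metric by blast
  let ?B = "norm (g (Suc n) a) + 1"
  have "norm (g 0 x - (\<Sum>i\<le>n. g i a * (x - a) ^ i / fact i)) \<le> ?B / fact n * norm ((x - a) ^ Suc n)"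
    if "dist x a < r" for x
  proof -
    have "norm (g 0 x - (\<Sum>i\<le>n. g i a * (x - a) ^ i / fact i)) \<le> ?B * norm (x - a) ^ Suc n / fact n"
      using r that
      by (intro field_Taylor[where S = "ball a r"])
        (auto simp: dist_commute intro!: has_field_derivative_at_within g less_imp_le)
    then show ?thesis by (simp add: norm_power del: power_Suc)
  qed
  then have "eventually (\<lambda>x. norm (g 0 x - (\<Sum>i\<le>n. g i a * (x - a) ^ i / fact i))
      \<le> ?B / fact n * norm ((x - a) ^ Suc n)) (nhds a)"
    unfolding eventually_nhds_metric using r(1) by blast
  then show ?thesis by (rule bigoI)
qed

lemma smooth_near_Taylor:
  assumes "smooth_near f a"
  shows "(\<lambda>x. f x - (\<Sum>i\<le>n. (deriv ^^ i) f a * (x - a) ^ i / fact i)) \<in> O[nhds a](\<lambda>x. (x - a) ^ Suc n)"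
proof -
  obtain S where S: "open S" "a \<in> S" "\<And>n x. x \<in> S \<Longrightarrow> (deriv ^^ n) f field_differentiable (at x)"
    using assms unfolding smooth_near_def by blast
  have "((deriv ^^ i) f has_field_derivative (deriv ^^ Suc i) f x) (at x)" if "x \<in> S" for i x
    using S(3)[OF that, of i] by (simp add: DERIV_deriv_iff_field_differentiable)
  from Taylor_bigo[of S a "\<lambda>i. (deriv ^^ i) f", OF S(1,2) this] show ?thesis by simp
qed

lemma smooth_near_deriv: "smooth_near f a \<Longrightarrow> smooth_near (deriv f) a"
  unfolding smooth_near_def by (metis funpow_Suc_right o_apply)

lemma analytic_smooth_near:
  fixes f :: "complex \<Rightarrow> complex"
  assumes "f analytic_on {a}"
  shows "smooth_near f a"
proof -
  obtain r where "r > 0" "f holomorphic_on ball a r"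
    using assms by (auto simp: analytic_on_def)
  then show ?thesis unfolding smooth_near_def
    by (intro exI[of _ "ball a r"])
      (auto intro!: holomorphic_on_imp_differentiable_at holomorphic_higher_deriv)
qed

lemma sum_atMost_3: "(\<Sum>i\<le>3::nat. f i) = f 0 + f 1 + f 2 + (f 3 :: 'a::comm_monoid_add)"
  by (simp add: numeral_3_eq_3 numeral_2_eq_2)

lemma jet_Taylor:
  fixes g :: "nat \<Rightarrow> 'a::real_normed_field \<Rightarrow> 'a"
  assumes "open S" "a \<in> S"
      and "\<And>i x. x \<in> S \<Longrightarrow> (g i has_field_derivative g (Suc i) x) (at x)"
  shows "jet (nhds a) (\<lambda>x. x - a) (g 0) (g 0 a) (g 1 a) (g 2 a / 2) (g 3 a / 6)"
  using Taylor_bigo[where g = g and n = 3, OF assms] unfolding jet_def sum_atMost_3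
  by (simp add: fact_numeral)

lemma smooth_near_jet:
  assumes "smooth_near f a"
  shows "jet (nhds a) (\<lambda>x. x - a) f (f a) (deriv f a) ((deriv ^^ 2) f a / 2) ((deriv ^^ 3) f a / 6)"
  using smooth_near_Taylor[OF assms, of 3] unfolding jet_def sum_atMost_3
  by (simp add: fact_numeral)

text \<open>The start of the binomial series: the derivative of order \<open>i\<close> is a falling
  factorial times \<open>z powr (a - of_nat i)\<close>. The differentiation rule and the value at 1
  are hypotheses, so that real and complex powers share the argument.\<close>

lemma powr_jet:
  fixes a :: "'a::{real_normed_field,ln}"
  assumes S: "open S" "1 \<in> S"
      and d: "\<And>b z :: 'a. z \<in> S \<Longrightarrow> ((\<lambda>z. z powr b) has_field_derivative b * z powr (b - 1)) (at z)"
      and one: "\<And>b :: 'a. 1 powr b = 1"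
  shows "jet (nhds 1) (\<lambda>z. z - 1) (\<lambda>z. z powr a) 1 a (a * (a - 1) / 2) (a * (a - 1) * (a - 2) / 6)"
proof -
  define g where "g i z = (\<Prod>j<i. a - of_nat j) * z powr (a - of_nat i)" for i :: nat and z
  have "(g i has_field_derivative g (Suc i) z) (at z)" if "z \<in> S" for i z
    unfolding g_def
    by (rule DERIV_cong[OF DERIV_cmult[OF d[OF that]]]) (simp add: algebra_simps)
  from jet_Taylor[where g = g, OF S this] show ?thesis
    unfolding g_def by (simp add: one numeral_2_eq_2 numeral_3_eq_3 algebra_simps)
qed

lemma powr_jet_real:
  fixes a :: real
  shows "jet (nhds 1) (\<lambda>z. z - 1) (\<lambda>z. z powr a) 1 a (a * (a - 1) / 2) (a * (a - 1) * (a - 2) / 6)"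
  by (rule powr_jet[of "{0<..}"]) (auto intro!: has_real_derivative_powr)

lemma powr_jet_complex:
  fixes a :: complex
  shows "jet (nhds 1) (\<lambda>z. z - 1) (\<lambda>z. z powr a) 1 a (a * (a - 1) / 2) (a * (a - 1) * (a - 2) / 6)"
  by (rule powr_jet[of "- \<real>\<^sub>\<le>\<^sub>0"]) (auto intro!: has_field_derivative_powr simp: closed_nonpos_Reals_complex open_Compl)

section \<open>Taylor expansion of a weight function of two variables\<close>

lemma Ck2_partials:
  assumes "\<forall>k. Ck2 S k Q"
  shows "\<forall>k. Ck2 S k (partial_u Q)" "\<forall>k. Ck2 S k (partial_v Q)"
  using assms Ck2.simps(2) by blast+

lemma Ck2_partials_iterated:
  assumes "\<forall>k. Ck2 S k Q"
  shows "\<forall>k. Ck2 S k ((partial_v ^^ j) ((partial_u ^^ i) Q))"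
proof -
  have "\<forall>k. Ck2 S k ((partial_u ^^ i) Q)" for i
    by (induction i) (use assms in \<open>simp_all add: Ck2_partials\<close>)
  then show ?thesis
    by (induction j) (simp_all add: Ck2_partials)
qed

lemma Ck2_has_partials:
  assumes "\<forall>k. Ck2 S k Q" "(u, v) \<in> S"
  shows "((\<lambda>s. Q s v) has_field_derivative partial_u Q u v) (at u)"
        "((\<lambda>t. Q u t) has_field_derivative partial_v Q u v) (at v)"
proof -
  have "Ck2 S (Suc 0) Q" using assms(1) by blast
  then have "(\<lambda>s. Q s v) field_differentiable (at u)" "(\<lambda>t. Q u t) field_differentiable (at v)"
    using assms(2) unfolding Ck2.simps by auto
  then show "((\<lambda>s. Q s v) has_field_derivative partial_u Q u v) (at u)"
        "((\<lambda>t. Q u t) has_field_derivative partial_v Q u v) (at v)"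
    unfolding partial_u_def partial_v_def by (simp_all add: DERIV_deriv_iff_field_differentiable)
qed

text \<open>Expanding in \<open>u\<close> before \<open>v\<close> produces the derivative \<open>\<partial>\<^sub>v \<partial>\<^sub>u Q\<close> directly, so that the
  symmetry of the mixed partial derivatives is not needed.\<close>

lemma smooth2_Taylor_u:
  fixes Q :: "'a::real_normed_field \<Rightarrow> 'a \<Rightarrow> 'a"
  assumes S: "open S" "(0, 0) \<in> S" and Q: "\<forall>k. Ck2 S k Q"
      and u: "(u \<longlongrightarrow> 0) F" and v: "(v \<longlongrightarrow> 0) F"
  shows "(\<lambda>x. Q (u x) (v x) - (\<Sum>i\<le>n. (partial_u ^^ i) Q 0 (v x) * u x ^ i / fact i))
           \<in> O[F](\<lambda>x. u x ^ Suc n)"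
proof -
  let ?D = "\<lambda>i. (partial_u ^^ i) Q"
  have D: "\<forall>k. Ck2 S k (?D i)" for i
    using Ck2_partials_iterated[OF Q, of 0 i] by simp
  define B where "B = norm (?D (Suc n) 0 0) + 1"
  have "Ck2 S 0 (?D (Suc n))"
    using D by blast
  then have "continuous_on S (\<lambda>(u, v). ?D (Suc n) u v)"
    unfolding Ck2.simps .
  then have "isCont (\<lambda>(u, v). ?D (Suc n) u v) (0, 0)"
    using S by (metis continuous_on_eq_continuous_at)
  then have "((\<lambda>(u, v). ?D (Suc n) u v) \<longlongrightarrow> ?D (Suc n) 0 0) (nhds (0, 0))"
    unfolding isCont_def tendsto_at_iff_tendsto_nhds by simp
  then have "eventually (\<lambda>p. norm (case p of (u, v) \<Rightarrow> ?D (Suc n) u v) < B) (nhds (0, 0))"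
    by (intro order_tendstoD(2)[OF tendsto_norm]) (auto simp: B_def)
  moreover have "eventually (\<lambda>p. p \<in> S) (nhds (0, 0))"
    using S by (rule eventually_nhds_in_open)
  ultimately have "eventually (\<lambda>p. p \<in> S \<and> norm (case p of (u, v) \<Rightarrow> ?D (Suc n) u v) < B) (nhds (0, 0))"
    by eventually_elim auto
  then obtain T where T: "open T" "(0, 0) \<in> T"
     "\<And>p. p \<in> T \<Longrightarrow> p \<in> S \<and> norm (case p of (u, v) \<Rightarrow> ?D (Suc n) u v) < B"
    unfolding eventually_nhds by blast
  \<comment> \<open>In a product neighborhood the ball of radius \<open>r\<close> in the first
    variable stays inside \<open>T\<close> for every \<open>t\<close> in \<open>T2\<close>. The
    remainder constant of the expansion in the first variable is therefore uniform in the
    second.\<close>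
  obtain T1 T2 where T12: "open T1" "open T2" "(0, 0) \<in> T1 \<times> T2" "T1 \<times> T2 \<subseteq> T"
    using open_prod_elim[OF T(1,2)] .
  obtain r where r: "r > 0" "ball 0 r \<subseteq> T1"
    using T12 open_contains_ball by (metis mem_Sigma_iff)
  have bound: "norm (Q s t - (\<Sum>i\<le>n. ?D i 0 t * s ^ i / fact i)) \<le> B / fact n * norm (s ^ Suc n)"
    if "s \<in> ball 0 r" "t \<in> T2" for s t
  proof -
    have inT: "(x, t) \<in> T" if "x \<in> ball 0 r" for x
      using that \<open>t \<in> T2\<close> r T12 by auto
    have "norm ((\<lambda>i s. ?D i s t) 0 s - (\<Sum>i\<le>n. (\<lambda>i s. ?D i s t) i 0 * (s - 0) ^ i / fact i))
        \<le> B * norm (s - 0) ^ Suc n / fact n"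
    proof (rule field_Taylor[where S = "ball 0 r"])
      fix i and x :: 'a assume "x \<in> ball 0 r"
      then have "(x, t) \<in> S" using inT T(3) by blast
      from Ck2_has_partials(1)[OF D[of i] this]
      show "((\<lambda>s. ?D i s t) has_field_derivative ?D (Suc i) x t) (at x within ball 0 r)"
        by (simp add: has_field_derivative_at_within)
    next
      fix x :: 'a assume "x \<in> ball 0 r"
      then show "norm (?D (Suc n) x t) \<le> B"
        using T(3)[OF inT[of x]] by (auto intro!: less_imp_le)
    qed (use r that in auto)
    then show ?thesis by (simp add: norm_power del: power_Suc)
  qed
  have "eventually (\<lambda>x. u x \<in> ball 0 r) F" "eventually (\<lambda>x. v x \<in> T2) F"
    using topological_tendstoD[OF u open_ball, of 0 r] topological_tendstoD[OF v T12(2)] r T12(3) by auto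
  then have "eventually (\<lambda>x. norm (Q (u x) (v x) - (\<Sum>i\<le>n. ?D i 0 (v x) * u x ^ i / fact i))
      \<le> B / fact n * norm (u x ^ Suc n)) F"
    by eventually_elim (rule bound)
  then show ?thesis by (rule bigoI)
qed

text \<open>With \<open>u\<close> of order \<open>e\<close> and \<open>v\<close> of order
  \<open>e ^ 2\<close>, the monomials \<open>v ^ 2\<close> and \<open>u ^ 2 * v\<close> and all
  higher ones are already of fourth order, which leaves exactly the listed terms.\<close>

lemma smooth2_Taylor:
  fixes Q :: "'a::real_normed_field \<Rightarrow> 'a \<Rightarrow> 'a"
  assumes Q: "smooth2_near Q 0 0" and e: "(e \<longlongrightarrow> 0) F"
      and u: "u \<in> O[F](e)" and v: "v \<in> O[F](\<lambda>x. e x ^ 2)"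
  shows "(\<lambda>x. Q (u x) (v x) -
      (Q 0 0 + partial_u Q 0 0 * u x + partial_u (partial_u Q) 0 0 / 2 * u x ^ 2
       + partial_u (partial_u (partial_u Q)) 0 0 / 6 * u x ^ 3
       + partial_v Q 0 0 * v x + partial_v (partial_u Q) 0 0 * u x * v x)) \<in> O[F](\<lambda>x. e x ^ 4)"
proof -
  obtain S where S: "open S" "(0, 0) \<in> S" "\<forall>k. Ck2 S k Q"
    using Q unfolding smooth2_near_def by blast
  let ?D = "\<lambda>j i. (partial_v ^^ j) ((partial_u ^^ i) Q)"
  have u0: "(u \<longlongrightarrow> 0) F" and v0: "(v \<longlongrightarrow> 0) F"
    using tendsto_of_bigo_power[OF e, of u 1] tendsto_of_bigo_power[OF e v] u by auto
  have un: "(\<lambda>x. u x ^ n) \<in> O[F](\<lambda>x. e x ^ n)" for n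
    using u by (rule landau_o.big_power)
  have one: "(\<lambda>x. Q (u x) (v x) - (\<Sum>i\<le>3. ?D 0 i 0 (v x) * u x ^ i / fact i)) \<in> O[F](\<lambda>x. e x ^ 4)"
    using landau_o.big_trans[OF smooth2_Taylor_u[OF S u0 v0, of 3]] un[of 4] by simp
  \<comment> \<open>The coefficients of the expansion in \<open>u\<close> still depend on
    \<open>v\<close>; each is expanded along the line where the first variable is 0.\<close>
  have Dv: "(\<lambda>x. ?D 0 i 0 (v x) - (\<Sum>j\<le>n. ?D j i 0 0 * v x ^ j / fact j)) \<in> O[F](\<lambda>x. v x ^ Suc n)" for i n
  proof -
    have "(\<lambda>t. ?D 0 i 0 t - (\<Sum>j\<le>n. ?D j i 0 0 * (t - 0) ^ j / fact j)) \<in> O[nhds 0](\<lambda>t. (t - 0) ^ Suc n)"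
    proof (rule Taylor_bigo[where g = "\<lambda>j t. ?D j i 0 t" and S = "Pair 0 -` S"])
      show "open (Pair 0 -` S)"
        using S(1) by (intro open_vimage continuous_intros)
      fix j t assume "t \<in> Pair 0 -` S"
      then show "((\<lambda>t. ?D j i 0 t) has_field_derivative ?D (Suc j) i 0 t) (at t)"
        using Ck2_has_partials(2)[OF Ck2_partials_iterated[OF S(3), of j i], of 0 t] by simp
    qed (use S in auto)
    from landau_o.big.compose[OF this v0] show ?thesis by simp
  qed
  have v2: "(\<lambda>x. v x ^ 2) \<in> O[F](\<lambda>x. e x ^ 4)"
    using landau_o.big_power[OF v, of 2] by simp
  have D0: "(\<lambda>x. ?D 0 0 0 (v x) - (Q 0 0 + partial_v Q 0 0 * v x)) \<in> O[F](\<lambda>x. e x ^ 4)"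
    using landau_o.big_trans[OF Dv[of 0 1]] v2 by (simp add: numeral_2_eq_2)
  have D1: "(\<lambda>x. ?D 0 1 0 (v x) - (partial_u Q 0 0 + partial_v (partial_u Q) 0 0 * v x)) \<in> O[F](\<lambda>x. e x ^ 4)"
    using landau_o.big_trans[OF Dv[of 1 1]] v2 by (simp add: numeral_2_eq_2)
  \<comment> \<open>For the coefficients of \<open>u ^ 2\<close> and \<open>u ^ 3\<close> the value
    at \<open>v = 0\<close> is enough: the error \<open>O(e ^ 2)\<close> is multiplied by at least
    \<open>u ^ 2\<close>.\<close>
  have Di: "(\<lambda>x. ?D 0 i 0 (v x) - ?D 0 i 0 0) \<in> O[F](\<lambda>x. e x ^ 2)" for i
    using landau_o.big_trans[OF Dv[of i 0]] v by simp
  have e5: "(\<lambda>x. e x ^ 5) \<in> O[F](\<lambda>x. e x ^ 4)"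
    by (rule power_in_bigo_power[OF e]) simp
  have 1: "(\<lambda>x. (?D 0 1 0 (v x) - (partial_u Q 0 0 + partial_v (partial_u Q) 0 0 * v x)) * u x)
      \<in> O[F](\<lambda>x. e x ^ 4)"
    using landau_o.big.trans[OF landau_o.big.mult[OF D1 u]] e5 by (simp add: eval_nat_numeral mult_ac)
  have 2: "(\<lambda>x. (?D 0 2 0 (v x) - ?D 0 2 0 0) * u x ^ 2) \<in> O[F](\<lambda>x. e x ^ 4)"
    using landau_o.big.mult[OF Di[of 2] un[of 2]] by (simp flip: power_add)
  have 3: "(\<lambda>x. (?D 0 3 0 (v x) - ?D 0 3 0 0) * u x ^ 3) \<in> O[F](\<lambda>x. e x ^ 4)"
    using landau_o.big.trans[OF landau_o.big.mult[OF Di[of 3] un[of 3]]] e5 by (simp flip: power_add)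
  have "(\<lambda>x. (Q (u x) (v x) - (\<Sum>i\<le>3. ?D 0 i 0 (v x) * u x ^ i / fact i))
      + (?D 0 0 0 (v x) - (Q 0 0 + partial_v Q 0 0 * v x))
      + (?D 0 1 0 (v x) - (partial_u Q 0 0 + partial_v (partial_u Q) 0 0 * v x)) * u x
      + 1 / 2 * ((?D 0 2 0 (v x) - ?D 0 2 0 0) * u x ^ 2)
      + 1 / 6 * ((?D 0 3 0 (v x) - ?D 0 3 0 0) * u x ^ 3)) \<in> O[F](\<lambda>x. e x ^ 4)"
    by (intro sum_in_bigo one D0 1 cmult_in_bigo_iff[THEN iffD2] disjI2 2 3)
  also have "(\<lambda>x. (Q (u x) (v x) - (\<Sum>i\<le>3. ?D 0 i 0 (v x) * u x ^ i / fact i))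
      + (?D 0 0 0 (v x) - (Q 0 0 + partial_v Q 0 0 * v x))
      + (?D 0 1 0 (v x) - (partial_u Q 0 0 + partial_v (partial_u Q) 0 0 * v x)) * u x
      + 1 / 2 * ((?D 0 2 0 (v x) - ?D 0 2 0 0) * u x ^ 2)
      + 1 / 6 * ((?D 0 3 0 (v x) - ?D 0 3 0 0) * u x ^ 3)) =
     (\<lambda>x. Q (u x) (v x) -
      (Q 0 0 + partial_u Q 0 0 * u x + partial_u (partial_u Q) 0 0 / 2 * u x ^ 2
       + partial_u (partial_u (partial_u Q)) 0 0 / 6 * u x ^ 3
       + partial_v Q 0 0 * v x + partial_v (partial_u Q) 0 0 * u x * v x))"
    unfolding sum_atMost_3
    by (rule ext) (simp add: fact_numeral algebra_simps numeral_2_eq_2 numeral_3_eq_3)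
  finally show ?thesis .
qed

section \<open>Normalized expansions at a multiple zero\<close>

lemma sum_atMost_add_3:
  "(\<Sum>i\<le>m + 3 :: nat. b i) = (\<Sum>i<m. b i) + b m + b (m + 1) + b (m + 2) + (b (m + 3) :: 'a::comm_monoid_add)"
  by (simp add: numeral_2_eq_2 numeral_3_eq_3 lessThan_Suc_atMost[symmetric])

text \<open>The Taylor polynomial of degree \<open>m + 3\<close> contains the factor
  \<open>(x - \<alpha>) ^ m\<close>, and dividing it out leaves four coefficients. The free scalar
  \<open>d\<close> allows the leading coefficient to be normalized to 1, both for a function with a
  multiple zero and for its derivative.\<close>

lemma divide_power_jet:
  fixes g :: "'a::real_normed_field \<Rightarrow> 'a"
  assumes g: "smooth_near g \<alpha>"
      and zero: "\<And>i. i < m \<Longrightarrow> (deriv ^^ i) g \<alpha> = 0" and d: "d \<noteq> 0"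
  shows "jet (at \<alpha>) (\<lambda>x. x - \<alpha>) (\<lambda>x. g x / (d * (x - \<alpha>) ^ m))
     ((deriv ^^ m) g \<alpha> / fact m / d) ((deriv ^^ (m + 1)) g \<alpha> / fact (m + 1) / d)
     ((deriv ^^ (m + 2)) g \<alpha> / fact (m + 2) / d) ((deriv ^^ (m + 3)) g \<alpha> / fact (m + 3) / d)"
proof -
  define a where "a i = (deriv ^^ i) g \<alpha> / fact i" for i
  have a0: "a i = 0" if "i < m" for i using zero[OF that] by (simp add: a_def)
  have "(\<lambda>x. g x - (\<Sum>i\<le>m + 3. a i * (x - \<alpha>) ^ i)) \<in> O[at \<alpha>](\<lambda>x. (x - \<alpha>) ^ Suc (m + 3))"
    using landau_o.big.filter_mono[OF _ smooth_near_Taylor[OF g, of "m + 3"], of "at \<alpha>"]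
    by (simp add: at_within_def a_def)
  also have "(\<lambda>x. (\<Sum>i\<le>m + 3. a i * (x - \<alpha>) ^ i)) =
      (\<lambda>x. (x - \<alpha>) ^ m * (a m + a (m + 1) * (x - \<alpha>) + a (m + 2) * (x - \<alpha>) ^ 2 + a (m + 3) * (x - \<alpha>) ^ 3))"
    by (rule ext) (simp add: sum_atMost_add_3 a0 power_add distrib_left mult_ac power2_eq_square)
  finally have "(\<lambda>x. g x - (x - \<alpha>) ^ m * (a m + a (m + 1) * (x - \<alpha>) + a (m + 2) * (x - \<alpha>) ^ 2 + a (m + 3) * (x - \<alpha>) ^ 3))
       \<in> O[at \<alpha>](\<lambda>x. (x - \<alpha>) ^ Suc (m + 3))" .
  moreover have ev: "eventually (\<lambda>x. d * (x - \<alpha>) ^ m \<noteq> 0) (at \<alpha>)"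
    unfolding eventually_at_filter using d by (intro always_eventually) auto
  ultimately have "(\<lambda>x. (g x - (x - \<alpha>) ^ m * (a m + a (m + 1) * (x - \<alpha>) + a (m + 2) * (x - \<alpha>) ^ 2 + a (m + 3) * (x - \<alpha>) ^ 3))
       / (d * (x - \<alpha>) ^ m)) \<in> O[at \<alpha>](\<lambda>x. (x - \<alpha>) ^ Suc (m + 3) / (d * (x - \<alpha>) ^ m))"
    by (intro landau_o.big.divide_right)
  also have "(\<lambda>x. (x - \<alpha>) ^ Suc (m + 3) / (d * (x - \<alpha>) ^ m)) \<in> O[at \<alpha>](\<lambda>x. (x - \<alpha>) ^ 4)"
  proof (rule bigoI[of _ "norm (1 / d)"], use ev in eventually_elim)
    case (elim x)
    have "(x - \<alpha>) ^ Suc (m + 3) = (x - \<alpha>) ^ 4 * (x - \<alpha>) ^ m"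
      by (simp flip: power_add)
    with elim show ?case by (simp add: norm_mult norm_divide)
  qed
  finally have r: "(\<lambda>x. (g x - (x - \<alpha>) ^ m * (a m + a (m + 1) * (x - \<alpha>) + a (m + 2) * (x - \<alpha>) ^ 2 + a (m + 3) * (x - \<alpha>) ^ 3))
       / (d * (x - \<alpha>) ^ m)) \<in> O[at \<alpha>](\<lambda>x. (x - \<alpha>) ^ 4)" .
  have "eventually (\<lambda>x. (g x - (x - \<alpha>) ^ m * (a m + a (m + 1) * (x - \<alpha>) + a (m + 2) * (x - \<alpha>) ^ 2 + a (m + 3) * (x - \<alpha>) ^ 3))
       / (d * (x - \<alpha>) ^ m) = g x / (d * (x - \<alpha>) ^ m) -
       (a m / d + a (m + 1) / d * (x - \<alpha>) + a (m + 2) / d * (x - \<alpha>) ^ 2 + a (m + 3) / d * (x - \<alpha>) ^ 3)) (at \<alpha>)"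
    unfolding eventually_at_filter
    by (intro always_eventually allI impI) (use d in \<open>simp add: diff_divide_distrib add_divide_distrib\<close>)
  with r show ?thesis
    unfolding jet_def a_def[symmetric] by (subst (asm) landau_o.big.in_cong) simp_all
qed

text \<open>\<open>F x = (x - \<alpha>) * unit_part f \<alpha> m x powr (1 / m)\<close> has a simple zero at \<open>\<alpha>\<close>, and
  \<open>m * f / f' = F / F'\<close>. The function \<open>A\<close> below stands for \<open>F'\<close>; only its expansion matters, so
  \<open>F\<close> need not be differentiated.\<close>

lemma newton_correction_jets:
  fixes f :: "'a::{real_normed_field,ln} \<Rightarrow> 'a"
  assumes m: "m \<ge> 1" and f: "smooth_near f \<alpha>" and z: "zero_of_multiplicity f \<alpha> m"
      and pw: "\<And>a :: 'a. jet (nhds 1) (\<lambda>z. z - 1) (\<lambda>z. z powr a) 1 a (a * (a - 1) / 2) (a * (a - 1) * (a - 2) / 6)"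
  obtains c2 c3 c4 A where
    "jet (nhds \<alpha>) (\<lambda>x. x - \<alpha>) (\<lambda>x. unit_part f \<alpha> m x powr (1 / of_nat m)) 1 c2 c3 c4"
    "jet (at \<alpha>) (\<lambda>x. x - \<alpha>) A 1 (2 * c2) (3 * c3) (4 * c4)"
    "eventually (\<lambda>x. of_nat m * (f x / deriv f x) =
        (x - \<alpha>) * unit_part f \<alpha> m x powr (1 / of_nat m) / A x) (at \<alpha>)"
proof -
  define c where "c = (deriv ^^ m) f \<alpha> / fact m"
  have c: "c \<noteq> 0" using z by (simp add: c_def zero_of_multiplicity_def)
  \<comment> \<open>The Taylor coefficients of the unit part of \<open>f\<close>, normalized so that
    \<open>h 0 = 1\<close>.\<close>
  define h where "h j = (deriv ^^ (m + j)) f \<alpha> / fact (m + j) / c" for j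
  define k :: 'a where "k = 1 / of_nat m"
  obtain n where n: "m = Suc n" using m by (cases m) auto
  have m0: "(of_nat m :: 'a) \<noteq> 0" using m by simp
  let ?e = "\<lambda>x. x - \<alpha>" and ?H = "unit_part f \<alpha> m"
  let ?G = "\<lambda>x. unit_part f \<alpha> m x powr k"
  \<comment> \<open>The unit part of \<open>deriv f\<close>, which has a zero of order
    \<open>n = m - 1\<close> with leading coefficient \<open>m * c\<close>.\<close>
  define E where "E x = deriv f x / (of_nat m * c * (x - \<alpha>) ^ n)" for x
  have e0n: "(?e \<longlongrightarrow> 0) (nhds \<alpha>)" and e0: "(?e \<longlongrightarrow> 0) (at \<alpha>)"
    by (auto intro!: tendsto_eq_intros filterlim_ident)

  have "jet (at \<alpha>) ?e (\<lambda>x. f x / (c * (x - \<alpha>) ^ m)) 1 (h 1) (h 2) (h 3)"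
    using divide_power_jet[OF f _ c, of m] z c
    by (simp add: h_def zero_of_multiplicity_def) (simp add: c_def)
  then have "jet (at \<alpha>) ?e ?H 1 (h 1) (h 2) (h 3)"
    by (rule jet_cong) (simp add: eventually_at_filter unit_part_def c_def)
  then have H: "jet (nhds \<alpha>) ?e ?H 1 (h 1) (h 2) (h 3)"
    by (rule jet_nhds) (simp add: unit_part_def)

  have der: "(deriv ^^ i) (deriv f) = (deriv ^^ Suc i) f" for i
    by (simp add: funpow_Suc_right del: funpow.simps)
  \<comment> \<open>Differentiation multiplies the coefficient of degree \<open>m + j\<close> by
    \<open>m + j\<close>; after division by \<open>m\<close> the factor is
    \<open>1 + j * k\<close>.\<close>
  have hj: "(deriv ^^ (n + j)) (deriv f) \<alpha> / fact (n + j) / (of_nat m * c) = (1 + of_nat j * k) * h j" for j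
  proof -
    have 1: "(fact (m + j) :: 'a) = of_nat (m + j) * fact (n + j)"
      by (simp add: n)
    have 2: "(of_nat (m + j) :: 'a) \<noteq> 0"
      using m by (metis add_eq_0_iff_both_eq_0 not_one_le_zero of_nat_eq_0_iff)
    have 3: "(1 + of_nat j * k) = of_nat (m + j) / of_nat m"
      using m0 by (simp add: k_def field_simps)
    have 4: "Suc (n + j) = m + j"
      by (simp add: n)
    show ?thesis
      unfolding h_def der 1 3 4 using 2 by simp
  qed
  have E: "jet (at \<alpha>) ?e E 1 ((1 + k) * h 1) ((1 + 2 * k) * h 2) ((1 + 3 * k) * h 3)"
  proof -
    have z': "(deriv ^^ i) (deriv f) \<alpha> = 0" if "i < n" for i
      unfolding der using z that by (simp add: zero_of_multiplicity_def n del: funpow.simps)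
    have "h 0 = 1" using c by (simp add: h_def c_def)
    then show ?thesis
      using divide_power_jet[OF smooth_near_deriv[OF f] z', of n "of_nat m * c"] m0 c
        hj[of 0] hj[of 1] hj[of 2] hj[of 3]
      unfolding E_def by simp
  qed

  have d: "jet (nhds \<alpha>) ?e (\<lambda>x. ?H x - 1) 0 (h 1) (h 2) (h 3)"
    using jet_diff[OF H jet_const[where c = 1]] by simp
  \<comment> \<open>Obtained by substituting the expansion of the unit part into the binomial series
    with exponent \<open>k\<close>.\<close>
  define c2 c3 c4 where "c2 = k * h 1" and "c3 = k * h 2 + k * (k - 1) / 2 * h 1 ^ 2"
    and "c4 = k * h 3 + 2 * (k * (k - 1) / 2) * h 1 * h 2 + k * (k - 1) * (k - 2) / 6 * h 1 ^ 3"
  have G: "jet (nhds \<alpha>) ?e ?G 1 c2 c3 c4"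
    unfolding c2_def c3_def c4_def
    by (rule jet_compose[OF e0n pw jet_tendsto[OF e0n H] d])
  have le: "at \<alpha> \<le> nhds \<alpha>" by (simp add: at_within_def)
  \<comment> \<open>The logarithmic derivative of \<open>(x - \<alpha>) * G x\<close> is
    \<open>deriv f x / (m * f x)\<close>, so its derivative has to be \<open>G * E / H\<close>. The
    factors 2, 3, 4 are those of termwise differentiation of
    \<open>e + c2 * e ^ 2 + c3 * e ^ 3 + c4 * e ^ 4\<close>.\<close>
  have A: "jet (at \<alpha>) ?e (\<lambda>x. ?G x * (E x / ?H x)) 1 (2 * c2) (3 * c3) (4 * c4)"
    by (rule jet_coeffs[OF jet_mult[OF e0 jet_mono[OF G le] jet_divide[OF e0 E jet_mono[OF H le]]]])
      (simp_all add: c2_def c3_def c4_def field_simps power2_eq_square power3_eq_cube)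
  have ne: "eventually (\<lambda>x. g x \<noteq> 0) (at \<alpha>)" if "(g \<longlongrightarrow> 1) (at \<alpha>)" for g :: "'a \<Rightarrow> 'a"
    using tendsto_imp_eventually_ne[OF that, of 0] by simp
  have "eventually (\<lambda>x. x \<noteq> \<alpha>) (at \<alpha>)" by (simp add: eventually_at_filter)
  moreover have "eventually (\<lambda>x. E x \<noteq> 0) (at \<alpha>)" "eventually (\<lambda>x. ?H x \<noteq> 0) (at \<alpha>)"
      "eventually (\<lambda>x. ?G x \<noteq> 0) (at \<alpha>)"
    using jet_tendsto[OF e0 E] jet_tendsto[OF e0 jet_mono[OF H le]] jet_tendsto[OF e0 jet_mono[OF G le]]
    by (auto intro: ne)
  ultimately have "eventually (\<lambda>x. of_nat m * (f x / deriv f x) = (x - \<alpha>) * ?G x / (?G x * (E x / ?H x))) (at \<alpha>)"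
  proof eventually_elim
    case (elim x)
    then have "(x - \<alpha>) * ?G x / (?G x * (E x / ?H x)) = (x - \<alpha>) * ?H x / E x"
      by simp
    also have "\<dots> = of_nat m * (f x / deriv f x)"
      using elim c m0 unfolding E_def unit_part_def c_def[symmetric] by (simp add: n field_simps)
    finally show ?case by simp
  qed
  then show thesis
    using that G A unfolding k_def by blast
qed

section \<open>The error of the three-point step\<close>

text \<open>The expansion \<open>pw\<close> at 1 is the only property of \<open>powr\<close> that
  enters, so real and complex scalars are treated together.\<close>

lemma three_point_order_eight:
  fixes f :: "'a::{real_normed_field,ln} \<Rightarrow> 'a"
  assumes m: "m \<ge> 1" and f: "smooth_near f \<alpha>" and zf: "zero_of_multiplicity f \<alpha> m"
      and P: "smooth_near P 0" and Q: "smooth2_near Q 0 0"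
      and wc: "weight_conditions P Q" and nc: "no_cubic_u_term Q"
      and pw: "\<And>a :: 'a. jet (nhds 1) (\<lambda>z. z - 1) (\<lambda>z. z powr a) 1 a (a * (a - 1) / 2) (a * (a - 1) * (a - 2) / 6)"
  shows "has_order_at 8 (\<lambda>x. f x \<noteq> 0 \<and> f (step_y f m x) \<noteq> 0) (three_point_step f \<alpha> m P Q) \<alpha>"
proof -
  define G where "G x = unit_part f \<alpha> m x powr (1 / of_nat m)" for x
  obtain c2 c3 c4 A where Gn: "jet (nhds \<alpha>) (\<lambda>x. x - \<alpha>) G 1 c2 c3 c4"
    and A_at: "jet (at \<alpha>) (\<lambda>x. x - \<alpha>) A 1 (2 * c2) (3 * c3) (4 * c4)"
    and N_at: "eventually (\<lambda>x. of_nat m * (f x / deriv f x) = (x - \<alpha>) * G x / A x) (at \<alpha>)"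
    using newton_correction_jets[OF m f zf pw] unfolding G_def by blast
  have f0: "f \<alpha> = 0"
    using zf m unfolding zero_of_multiplicity_def by (auto dest: spec[of _ 0])
  define D where "D = {x. f x \<noteq> 0 \<and> f (step_y f m x) \<noteq> 0}"
  \<comment> \<open>Here \<open>F\<close> is a filter; the function with a simple zero at \<alpha>
    is \<open>(x - \<alpha>) * G x\<close>. If \<open>D\<close> does not accumulate at \<alpha>, the
    filter is trivial and every estimate holds vacuously.\<close>
  define F where "F = at \<alpha> within D"
  define s where "s = (deriv ^^ 2) P 0 / 2"
  have le: "F \<le> at \<alpha>" "F \<le> nhds \<alpha>"
    unfolding F_def at_within_def by (auto intro: le_infI1 le_infI2)
  let ?e = "\<lambda>x. x - \<alpha>"
  have e: "(?e \<longlongrightarrow> 0) F"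
    unfolding F_def by (rule tendsto_eq_intros refl | simp)+
  note jet_tendsto = jet_tendsto[OF e] and jet_mult = jet_mult[OF e] and jet_divide = jet_divide[OF e]
    and jet_inverse = jet_inverse[OF e] and jet_compose = jet_compose[OF e]
    and jet_order1 = jet_order1[OF e] and jet_order2 = jet_order2[OF e]
  note algebra = algebra_simps power2_eq_square power3_eq_cube
  define y where "y = step_y f m"
  define u where "u x = root_ratio f \<alpha> m (y x) x" for x
  define z where "z = step_z f \<alpha> m P"
  define v where "v x = root_ratio f \<alpha> m (z x) (y x)" for x
  define N where "N x = of_nat m * (f x / deriv f x)" for x
  have ne: "eventually (\<lambda>x. g x \<noteq> 0) F" if "(g \<longlongrightarrow> 1) F" for g :: "'a \<Rightarrow> 'a"
    using tendsto_imp_eventually_ne[OF that, of 0] by simp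
  have eD: "eventually (\<lambda>x. x \<noteq> \<alpha> \<and> y x \<noteq> \<alpha>) F"
    unfolding F_def D_def y_def eventually_at_filter using f0 by (intro always_eventually) auto

  have jG: "jet F ?e G 1 c2 c3 c4" and jA: "jet F ?e A 1 (2 * c2) (3 * c3) (4 * c4)"
    using jet_mono Gn A_at le by blast+
  have N: "eventually (\<lambda>x. N x = ?e x * G x / A x) F"
    using N_at le(1) unfolding N_def by (rule filter_leD[rotated])
  have G0: "eventually (\<lambda>x. G x \<noteq> 0) F" and A0: "eventually (\<lambda>x. A x \<noteq> 0) F"
    using jet_tendsto[OF jG] jet_tendsto[OF jA] by (auto intro: ne)

  \<comment> \<open>The relative error of the Newton substep:
    \<open>y x - \<alpha> = (x - \<alpha>) * R x\<close>. Since \<open>x - \<alpha>\<close> cancels,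
    \<open>u\<close> becomes \<open>R x * G (y x) / G x\<close>.\<close>
  define R where "R x = 1 - G x / A x" for x
  have jR: "jet F ?e R 0 c2 (2 * c3 - 2 * c2 ^ 2) (4 * c2 ^ 3 - 7 * c2 * c3 + 3 * c4)"
    unfolding R_def
    by (rule jet_coeffs[OF jet_diff[OF jet_const[where c = 1] jet_divide[OF jG jA]]]) (simp_all add: algebra)
  have y: "eventually (\<lambda>x. y x - \<alpha> = ?e x * R x) F"
    using N by eventually_elim (simp add: y_def step_y_def R_def N_def algebra_simps)
  have jy: "jet F ?e (\<lambda>x. y x - \<alpha>) 0 0 c2 (2 * c3 - 2 * c2 ^ 2)"
    by (rule jet_cong[OF jet_coeffs[OF jet_mult[OF jet_id jR]]]) (use y in \<open>auto elim: eventually_mono\<close>)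
  have y_lim: "(y \<longlongrightarrow> \<alpha>) F"
    using jet_tendsto[OF jy] by (simp add: LIM_zero_iff)
  have jGy: "jet F ?e (\<lambda>x. G (y x)) 1 0 (c2 ^ 2) (2 * c2 * c3 - 2 * c2 ^ 3)"
    by (rule jet_coeffs[OF jet_compose[OF Gn y_lim jy]]) (simp_all add: algebra)
  have Gy0: "eventually (\<lambda>x. G (y x) \<noteq> 0) F"
    using jet_tendsto[OF jGy] by (rule ne)

  have u: "eventually (\<lambda>x. u x = R x * G (y x) / G x) F"
    using y eD by eventually_elim (simp add: u_def root_ratio_def G_def)
  have "jet F ?e (\<lambda>x. R x * G (y x) / G x) 0 c2 (2 * c3 - 3 * c2 ^ 2) (8 * c2 ^ 3 - 10 * c2 * c3 + 3 * c4)"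
    by (rule jet_coeffs[OF jet_divide[OF jet_mult[OF jR jGy] jG]]) (simp_all add: algebra)
  then have ju: "jet F ?e u 0 c2 (2 * c3 - 3 * c2 ^ 2) (8 * c2 ^ 3 - 10 * c2 * c3 + 3 * c4)"
    by (rule jet_cong) (use u in \<open>auto elim: eventually_mono\<close>)
  \<comment> \<open>The cubic coefficient is \<open>P'''(0) / 6 = 4 - P''(0)\<close>, that is
    \<open>4 - 2 * s\<close>.\<close>
  have jP: "jet (nhds 0) (\<lambda>t. t) P 1 2 s (4 - 2 * s)"
    using smooth_near_jet[OF P] wc unfolding weight_conditions_def s_def by (simp add: diff_divide_distrib)
  have jPu: "jet F ?e (\<lambda>x. P (u x)) 1 (2 * c2) (4 * c3 - 6 * c2 ^ 2 + s * c2 ^ 2)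
      (20 * c2 ^ 3 - 20 * c2 * c3 + 6 * c4 + s * (4 * c2 * c3 - 8 * c2 ^ 3))"
    by (rule jet_coeffs[OF jet_compose[OF jP jet_tendsto[OF ju] ju]]) (simp_all add: algebra)

  define W where "W x = 1 / G (y x) - P (u x) / A x" for x
  define w2 w3 where "w2 = 5 * c2 ^ 2 - c3 - s * c2 ^ 2"
    and "w3 = 20 * c2 * c3 - 30 * c2 ^ 3 - 2 * c4 + s * (10 * c2 ^ 3 - 4 * c2 * c3)"
  \<comment> \<open>The values \<open>P(0) = 1\<close> and \<open>P'(0) = 2\<close> are what cancels
    the coefficients of degree 0 and 1.\<close>
  have jW: "jet F ?e W 0 0 w2 w3"
    unfolding W_def w2_def w3_def
    by (rule jet_coeffs[OF jet_diff[OF jet_inverse[OF jGy] jet_divide[OF jPu jA]]]) (simp_all add: algebra)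
  \<comment> \<open>\<open>u\<close> times the correction \<open>N\<close> equals
    \<open>(y x - \<alpha>) * G (y x) / A x\<close>, because the factor
    \<open>(x - \<alpha>) * G x\<close> cancels.\<close>
  have z: "eventually (\<lambda>x. z x - \<alpha> = (y x - \<alpha>) * G (y x) * W x) F"
    using N y u eD G0 A0 Gy0
  proof eventually_elim
    case (elim x)
    have "z x - \<alpha> = (y x - \<alpha>) - u x * P (u x) * N x"
      by (simp add: z_def step_z_def Let_def y_def u_def N_def)
    also have "u x * P (u x) * N x = (y x - \<alpha>) * G (y x) * P (u x) / A x"
      using elim by simp
    finally show ?case using elim(7) by (simp add: W_def right_diff_distrib)
  qed
  have z4: "(\<lambda>x. z x - \<alpha>) \<in> O[F](\<lambda>x. ?e x ^ 4)"
  proof -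
    have "(\<lambda>x. (y x - \<alpha>) * G (y x) * W x) \<in> O[F](\<lambda>x. ?e x ^ 2 * 1 * ?e x ^ 2)"
      by (intro landau_o.big.mult jet_order2[OF jy] jet_order2[OF jW] bounded_of_tendsto[OF jet_tendsto[OF jGy]])
    then show ?thesis
      using z by (simp add: landau_o.big.in_cong flip: power_add)
  qed
  \<comment> \<open>At this precision \<open>z - \<alpha>\<close> is zero, hence
    \<open>G (z x)\<close> is 1 up to fourth order.\<close>
  then have jz: "jet F ?e (\<lambda>x. z x - \<alpha>) 0 0 0 0"
    by (simp add: jet_def)
  have z_lim: "(z \<longlongrightarrow> \<alpha>) F"
    using jet_tendsto[OF jz] by (simp add: LIM_zero_iff)
  have jGz: "jet F ?e (\<lambda>x. G (z x)) 1 0 0 0"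
    by (rule jet_coeffs[OF jet_compose[OF Gn z_lim jz]]) simp_all

  \<comment> \<open>The common factor \<open>(y x - \<alpha>) * G (y x)\<close> cancels, which is
    possible since both factors are eventually nonzero along \<open>F\<close>.\<close>
  have v: "eventually (\<lambda>x. v x = W x * G (z x)) F"
    using z eD Gy0 by eventually_elim (simp add: v_def root_ratio_def flip: G_def)
  have "jet F ?e (\<lambda>x. W x * G (z x)) 0 0 w2 w3"
    by (rule jet_coeffs[OF jet_mult[OF jW jGz]]) simp_all
  then have jv: "jet F ?e v 0 0 w2 w3"
    by (rule jet_cong) (use v in \<open>auto elim: eventually_mono\<close>)
  have Quv: "(\<lambda>x. Q (u x) (v x) - (1 + 2 * u x + (s + 1) * u x ^ 2 + v x + 4 * u x * v x)) \<in> O[F](\<lambda>x. ?e x ^ 4)"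
    using smooth2_Taylor[OF Q e jet_order1[OF ju] jet_order2[OF jv]] wc nc
    unfolding weight_conditions_def no_cubic_u_term_def s_def by (simp add: add_divide_distrib)
  \<comment> \<open>The conditions on the weights combine here: the polynomial in \<open>u\<close>
    and \<open>v\<close> reproduces the expansion of \<open>A\<close>. The parameter
    \<open>s\<close> cancels in degree 2 between \<open>u ^ 2\<close> and \<open>w2\<close>, and in
    degree 3 among \<open>u ^ 2\<close>, \<open>w3\<close> and \<open>4 * u * v\<close>.\<close>
  have "jet F ?e (\<lambda>x. 1 + 2 * u x + (s + 1) * (u x * u x) + v x + 4 * (u x * v x)) 1 (2 * c2) (3 * c3) (4 * c4)"
    by (rule jet_coeffs[OF jet_add[OF jet_add[OF jet_add[OF jet_add[OF jet_const[where c = 1] jet_cmult[OF ju, of 2]]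
            jet_cmult[OF jet_mult[OF ju ju], of "s + 1"]] jv] jet_cmult[OF jet_mult[OF ju jv], of 4]]])
      (simp_all add: w2_def w3_def algebra)
  then have jQ: "jet F ?e (\<lambda>x. Q (u x) (v x)) 1 (2 * c2) (3 * c3) (4 * c4)"
    by (rule jet_perturb) (use Quv in \<open>simp add: power2_eq_square mult.assoc\<close>)
  have "jet F ?e (\<lambda>x. 1 - G (z x) * Q (u x) (v x) / A x) 0 0 0 0"
    by (rule jet_coeffs[OF jet_diff[OF jet_const[where c = 1] jet_divide[OF jet_mult[OF jGz jQ] jA]]])
      (simp_all add: algebra)
  then have Q4: "(\<lambda>x. 1 - G (z x) * Q (u x) (v x) / A x) \<in> O[F](\<lambda>x. ?e x ^ 4)"
    by (simp add: jet_def)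
  \<comment> \<open>The product \<open>u * v * N\<close> collapses to
    \<open>(z x - \<alpha>) * G (z x) / A x\<close>, so the error of the second substep factors
    out.\<close>
  have step: "eventually (\<lambda>x. three_point_step f \<alpha> m P Q x - \<alpha> =
      (z x - \<alpha>) * (1 - G (z x) * Q (u x) (v x) / A x)) F"
    using N y u v z eD G0 A0 Gy0
  proof eventually_elim
    case (elim x)
    have "three_point_step f \<alpha> m P Q x - \<alpha> = (z x - \<alpha>) - u x * v x * Q (u x) (v x) * N x"
      by (simp add: three_point_step_def Let_def y_def z_def u_def v_def N_def)
    also have "u x * v x * Q (u x) (v x) * N x = (z x - \<alpha>) * G (z x) * Q (u x) (v x) / A x"
      using elim by simp
    finally show ?case by (simp add: right_diff_distrib)
  qed
  have "(\<lambda>x. three_point_step f \<alpha> m P Q x - \<alpha>) \<in> O[F](\<lambda>x. ?e x ^ 8)"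
    using landau_o.big.mult[OF z4 Q4] step by (simp add: landau_o.big.in_cong flip: power_add)
  then obtain C where "eventually (\<lambda>x. norm (three_point_step f \<alpha> m P Q x - \<alpha>) \<le> C * norm (?e x ^ 8)) F"
    by (auto elim: landau_o.bigE)
  \<comment> \<open>The point \<alpha> can be added because it is not in \<open>D\<close>, where
    \<open>f\<close> is nonzero.\<close>
  then have "eventually (\<lambda>x. x \<in> D \<longrightarrow> norm (three_point_step f \<alpha> m P Q x - \<alpha>) \<le> C * norm (x - \<alpha>) ^ 8) (nhds \<alpha>)"
    unfolding F_def eventually_at_filter
    by eventually_elim (use f0 in \<open>auto simp: D_def norm_power\<close>)
  then show ?thesis
    unfolding has_order_at_def D_def by auto
qed

theorem theorem2:
  fixes m :: nat
  assumes "m \<ge> 1"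
  shows
    "(\<forall>(f :: real \<Rightarrow> real) \<alpha> P Q.
        smooth_near f \<alpha> \<longrightarrow> zero_of_multiplicity f \<alpha> m \<longrightarrow>
        smooth_near P 0 \<longrightarrow> smooth2_near Q 0 0 \<longrightarrow>
        weight_conditions P Q \<longrightarrow> no_cubic_u_term Q \<longrightarrow>
        has_order_at 8 (\<lambda>x. f x \<noteq> 0 \<and> f (step_y f m x) \<noteq> 0) (three_point_step f \<alpha> m P Q) \<alpha>)
     \<and>
     (\<forall>(f :: complex \<Rightarrow> complex) \<alpha> P Q.
        f analytic_on {\<alpha>} \<longrightarrow> zero_of_multiplicity f \<alpha> m \<longrightarrow>
        P analytic_on {0} \<longrightarrow> smooth2_near Q 0 0 \<longrightarrow>
        weight_conditions P Q \<longrightarrow> no_cubic_u_term Q \<longrightarrow>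
        has_order_at 8 (\<lambda>x. f x \<noteq> 0 \<and> f (step_y f m x) \<noteq> 0) (three_point_step f \<alpha> m P Q) \<alpha>)"
  \<comment> \<open>Both scalar fields are instances of the general result; in the complex case
    analyticity supplies the smoothness of \<open>f\<close> and \<open>P\<close>.\<close>
  using three_point_order_eight[OF assms _ _ _ _ _ _ powr_jet_real]
    three_point_order_eight[OF assms _ _ _ _ _ _ powr_jet_complex] analytic_smooth_near
  by blast

end
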